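(* Fix real numbers $c<d$. The spaces $\mathrm{(fid)}$, $\mathrm{(ffid)}$ and $\mathrm{(ffid^{[c,d]})}$, with the topology induced by the interleaving distance, are separable (i.e. each has a countable dense subset).
   Context: Fix a field $\mathbf{k}$. A persistence module is a functor $M:(\mathbb{R},\le)\to \mathrm{Vect}_{\mathbf{k}}$; "persistence module" means isomorphism class. For an interval $J\subset\mathbb{R}$, the interval module $J$ is $\mathbf{k}$ at points of $J$ and $0$ elsewhere, with identity maps between points of $J$ and zero maps otherwise. For $\varepsilon\ge 0$, $M,N$ are $\varepsilon$-interleaved if there are families of linear maps $\varphi_a:M(a)\to N(a+\varepsilon)$ and $\psi_a:N(a)\to M(a+\varepsilon)$, natural in $a\in\mathbb{R}$, with $\psi_{a+\varepsilon}\varphi_a=M(a\le a+2\varepsilon)$ and $\varphi_{a+\varepsilon}\psi_a=N(a\le a+2\varepsilon)$ for all $a$. The interleaving distance is $d_I(M,N)=\inf\{\varepsilon\ge0 : M,N \text{ are } \varepsilon\text{-interleaved}\}$ ($\infty$ if there is none). It is an extended pseudometric; the induced topology has the open balls $B_r(M)=\{N: d_I(M,N)<r\}$, $r>0$, as a base. Sets of persistence modules: $\mathrm{(fid)}$: finite direct sums of interval modules (including the zero module); $\mathrm{(ffid)}$: those in $\mathrm{(fid)}$ with all intervals finite (bounded); $\mathrm{(ffid^{[c,d]})}$: those in $\mathrm{(ffid)}$ with all intervals contained in $[c,d]$. *)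

theory Defs
  imports "HOL-Analysis.Analysis" "HOL-Algebra.Module"
begin

text \<open>
  The ground field is a record \<open>R\<close> with \<open>field R\<close>, and a vector space over it is a record \<open>V\<close> with
  \<open>Module.module R V\<close>. Module records inherit the fields \<open>mult\<close> and \<open>one\<close> from ring records; these
  carry no information and are ignored throughout.
\<close>

definition linear_maps ::
  "('k, 'r) ring_scheme \<Rightarrow> ('k, 'v) module \<Rightarrow> ('k, 'w) module \<Rightarrow> ('v \<Rightarrow> 'w) set" where
  "linear_maps R V W = {f \<in> carrier V \<rightarrow> carrier W.
     (\<forall>x\<in>carrier V. \<forall>y\<in>carrier V. f (x \<oplus>\<^bsub>V\<^esub> y) = f x \<oplus>\<^bsub>W\<^esub> f y) \<and>
     (\<forall>k\<in>carrier R. \<forall>x\<in>carrier V. f (k \<odot>\<^bsub>V\<^esub> x) = k \<odot>\<^bsub>W\<^esub> f x)}"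


section \<open>Persistence modules\<close>

text \<open>
  \<open>pm_map M a b\<close> is the structure map \<open>M(a \<le> b)\<close>; its values are only meaningful for \<open>a \<le> b\<close> and on
  the carrier of \<open>pm_space M a\<close>.
\<close>

record ('k, 'v) pers =
  pm_space :: "real \<Rightarrow> ('k, 'v) module"
  pm_map :: "real \<Rightarrow> real \<Rightarrow> 'v \<Rightarrow> 'v"

locale persistence_module = Ring.field R for R :: "('k, 'r) ring_scheme" (structure) +
  fixes M :: "('k, 'v) pers"
  assumes vector_space: "Module.module R (pm_space M a)"
    and linear: "a \<le> b \<Longrightarrow> pm_map M a b \<in> linear_maps R (pm_space M a) (pm_space M b)"
    and identity: "x \<in> carrier (pm_space M a) \<Longrightarrow> pm_map M a a x = x"
    and composition: "a \<le> b \<Longrightarrow> b \<le> c \<Longrightarrow> x \<in> carrier (pm_space M a) \<Longrightarrow>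
          pm_map M b c (pm_map M a b x) = pm_map M a c x"

text \<open>Natural families of linear maps \<open>M(a) \<rightarrow> N(a + \<epsilon>)\<close>; for \<open>\<epsilon> = 0\<close>, morphisms of functors.\<close>

definition shift_morphism ::
  "('k, 'r) ring_scheme \<Rightarrow> real \<Rightarrow> ('k, 'v) pers \<Rightarrow> ('k, 'w) pers \<Rightarrow> (real \<Rightarrow> 'v \<Rightarrow> 'w) \<Rightarrow> bool" where
  "shift_morphism R \<epsilon> M N \<phi> \<longleftrightarrow>
     (\<forall>a. \<phi> a \<in> linear_maps R (pm_space M a) (pm_space N (a + \<epsilon>))) \<and>
     (\<forall>a b. a \<le> b \<longrightarrow> (\<forall>x\<in>carrier (pm_space M a).
        \<phi> b (pm_map M a b x) = pm_map N (a + \<epsilon>) (b + \<epsilon>) (\<phi> a x)))"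

definition pm_iso :: "('k, 'r) ring_scheme \<Rightarrow> ('k, 'v) pers \<Rightarrow> ('k, 'w) pers \<Rightarrow> bool" where
  "pm_iso R M N \<longleftrightarrow> (\<exists>f g. shift_morphism R 0 M N f \<and> shift_morphism R 0 N M g \<and>
     (\<forall>a. \<forall>x\<in>carrier (pm_space M a). g a (f a x) = x) \<and>
     (\<forall>a. \<forall>y\<in>carrier (pm_space N a). f a (g a y) = y))"

definition interleaved ::
  "('k, 'r) ring_scheme \<Rightarrow> real \<Rightarrow> ('k, 'v) pers \<Rightarrow> ('k, 'w) pers \<Rightarrow> bool" where
  "interleaved R \<epsilon> M N \<longleftrightarrow> (\<exists>\<phi> \<psi>. shift_morphism R \<epsilon> M N \<phi> \<and> shift_morphism R \<epsilon> N M \<psi> \<and>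
     (\<forall>a. \<forall>x\<in>carrier (pm_space M a). \<psi> (a + \<epsilon>) (\<phi> a x) = pm_map M a (a + 2 * \<epsilon>) x) \<and>
     (\<forall>a. \<forall>y\<in>carrier (pm_space N a). \<phi> (a + \<epsilon>) (\<psi> a y) = pm_map N a (a + 2 * \<epsilon>) y))"

text \<open>In \<open>ereal\<close> the infimum of the empty set is \<open>\<infinity>\<close>.\<close>

definition interleaving_dist ::
  "('k, 'r) ring_scheme \<Rightarrow> ('k, 'v) pers \<Rightarrow> ('k, 'w) pers \<Rightarrow> ereal" where
  "interleaving_dist R M N = (INF \<epsilon>\<in>{\<epsilon>. 0 \<le> \<epsilon> \<and> interleaved R \<epsilon> M N}. ereal \<epsilon>)"


section \<open>Interval modules and finite direct sums\<close>

definition interval_module :: "('k, 'r) ring_scheme \<Rightarrow> real set \<Rightarrow> ('k, 'k) pers" where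
  "interval_module R J = \<lparr>
     pm_space = (\<lambda>a. \<lparr>carrier = (if a \<in> J then carrier R else {\<zero>\<^bsub>R\<^esub>}),
        mult = undefined, one = undefined,
        zero = \<zero>\<^bsub>R\<^esub>, add = add R, smult = mult R\<rparr>),
     pm_map = (\<lambda>a b x. if a \<in> J \<and> b \<in> J then x else \<zero>\<^bsub>R\<^esub>)\<rparr>"

text \<open>
  For finite \<open>I\<close> the direct sum is the product; it is used here for finite \<open>I\<close> only. For \<open>I = {}\<close> the
  carrier is a singleton, i.e. the sum is the zero module.
\<close>

definition direct_sum :: "'i set \<Rightarrow> ('i \<Rightarrow> ('k, 'v) pers) \<Rightarrow> ('k, 'i \<Rightarrow> 'v) pers" where
  "direct_sum I M = \<lparr>
     pm_space = (\<lambda>a. \<lparr>carrier = (\<Pi>\<^sub>E i\<in>I. carrier (pm_space (M i) a)),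
        mult = undefined, one = undefined,
        zero = (\<lambda>i\<in>I. \<zero>\<^bsub>pm_space (M i) a\<^esub>),
        add = (\<lambda>x y. \<lambda>i\<in>I. x i \<oplus>\<^bsub>pm_space (M i) a\<^esub> y i),
        smult = (\<lambda>k x. \<lambda>i\<in>I. k \<odot>\<^bsub>pm_space (M i) a\<^esub> x i)\<rparr>),
     pm_map = (\<lambda>a b x. \<lambda>i\<in>I. pm_map (M i) a b (x i))\<rparr>"


section \<open>Spaces of isomorphism classes\<close>

text \<open>
  Isomorphism classes are taken among the persistence modules whose spaces have their carriers in
  \<open>nat \<Rightarrow> 'k\<close>. This is the carrier type of the direct sums of interval modules indexed by \<open>{..<n}\<close>, so
  every finite direct sum of interval modules has a representative there.
\<close>

definition iso_class ::
  "('k, 'r) ring_scheme \<Rightarrow> ('k, nat \<Rightarrow> 'k) pers \<Rightarrow> ('k, nat \<Rightarrow> 'k) pers set" where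
  "iso_class R M = {N. persistence_module R N \<and> pm_iso R M N}"

text \<open>
  The distance of two classes is the distance of any two representatives, see
  \<open>class_dist_iso_class\<close> below.
\<close>

definition class_dist ::
  "('k, 'r) ring_scheme \<Rightarrow> ('k, nat \<Rightarrow> 'k) pers set \<Rightarrow> ('k, nat \<Rightarrow> 'k) pers set \<Rightarrow> ereal" where
  "class_dist R X Y = (INF M\<in>X. INF N\<in>Y. interleaving_dist R M N)"

text \<open>
  The balls, relative to \<open>\<S>\<close>, form a base because the distance is an extended pseudometric, so the
  topology they generate is the one having them as a base.
\<close>

definition interleaving_topology ::
  "('k, 'r) ring_scheme \<Rightarrow> ('k, nat \<Rightarrow> 'k) pers set set \<Rightarrow> ('k, nat \<Rightarrow> 'k) pers set topology" where
  "interleaving_topology R \<S> =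
     topology_generated_by {{Y \<in> \<S>. class_dist R X Y < ereal r} | X r. X \<in> \<S> \<and> 0 < r}"

definition fid :: "('k, 'r) ring_scheme \<Rightarrow> ('k, nat \<Rightarrow> 'k) pers set set" where
  "fid R = {iso_class R (direct_sum {..<n} (\<lambda>i. interval_module R (J i))) | n J.
     \<forall>i<n. is_interval (J i) \<and> J i \<noteq> {}}"

definition ffid :: "('k, 'r) ring_scheme \<Rightarrow> ('k, nat \<Rightarrow> 'k) pers set set" where
  "ffid R = {iso_class R (direct_sum {..<n} (\<lambda>i. interval_module R (J i))) | n J.
     \<forall>i<n. is_interval (J i) \<and> J i \<noteq> {} \<and> bounded (J i)}"

definition ffid_within ::
  "('k, 'r) ring_scheme \<Rightarrow> real \<Rightarrow> real \<Rightarrow> ('k, nat \<Rightarrow> 'k) pers set set" where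
  "ffid_within R c d = {iso_class R (direct_sum {..<n} (\<lambda>i. interval_module R (J i))) | n J.
     \<forall>i<n. is_interval (J i) \<and> J i \<noteq> {} \<and> bounded (J i) \<and> J i \<subseteq> {c..d}}"


section \<open>Well-definedness\<close>

lemma linear_mapsD:
  assumes "f \<in> linear_maps R V W"
  shows "x \<in> carrier V \<Longrightarrow> f x \<in> carrier W"
    and "x \<in> carrier V \<Longrightarrow> y \<in> carrier V \<Longrightarrow> f (x \<oplus>\<^bsub>V\<^esub> y) = f x \<oplus>\<^bsub>W\<^esub> f y"
    and "k \<in> carrier R \<Longrightarrow> x \<in> carrier V \<Longrightarrow> f (k \<odot>\<^bsub>V\<^esub> x) = k \<odot>\<^bsub>W\<^esub> f x"
  using assms by (auto simp: linear_maps_def)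

lemma interval_module_persistence:
  assumes "Ring.field R" "is_interval J"
  shows "persistence_module R (interval_module R J)"
proof -
  interpret Ring.field R by fact
  have mem: "b \<in> J" if "a \<in> J" "c \<in> J" "a \<le> b" "b \<le> c" for a b c
    using that assms(2) unfolding is_interval_1 by blast
  have ag: "abelian_group (pm_space (interval_module R J) a)" for a
  proof (rule abelian_groupI)
    fix x assume x: "x \<in> carrier (pm_space (interval_module R J) a)"
    show "\<exists>y\<in>carrier (pm_space (interval_module R J) a).
        y \<oplus>\<^bsub>pm_space (interval_module R J) a\<^esub> x = \<zero>\<^bsub>pm_space (interval_module R J) a\<^esub>"
      using x by (intro bexI[where x = "\<ominus>\<^bsub>R\<^esub> x"])
        (auto simp: interval_module_def l_neg split: if_splits)
  qed (auto simp: interval_module_def a_ac split: if_splits)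
  have mod: "Module.module R (pm_space (interval_module R J) a)" for a
    by (rule Module.moduleI[OF _ ag])
      (auto simp: interval_module_def l_distr r_distr m_assoc is_cring split: if_splits)
  show ?thesis
  proof (intro persistence_module.intro persistence_module_axioms.intro)
    fix a b c x
    assume *: "a \<le> b" "b \<le> c" and "x \<in> carrier (pm_space (interval_module R J) a)"
    then show "pm_map (interval_module R J) b c (pm_map (interval_module R J) a b x) =
        pm_map (interval_module R J) a c x"
      using mem[OF _ _ *] by (auto simp: interval_module_def)
  qed (fact assms mod | auto simp: linear_maps_def interval_module_def split: if_splits)+
qed

lemma direct_sum_persistence:
  assumes R: "Ring.field R" and M: "\<And>i. i \<in> I \<Longrightarrow> persistence_module R (M i)"
  shows "persistence_module R (direct_sum I M)"
proof -
  interpret R: Ring.field R by fact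
  have m: "Module.module R (pm_space (M i) a)" if "i \<in> I" for i a
    using persistence_module.vector_space[OF M[OF that]] .
  have g: "abelian_group (pm_space (M i) a)" if "i \<in> I" for i a
    using m[OF that] by (rule Module.module.axioms(2))
  note gs = abelian_monoid.a_closed[OF abelian_group.axioms(1)[OF g]]
    abelian_monoid.zero_closed[OF abelian_group.axioms(1)[OF g]]
    abelian_monoid.a_assoc[OF abelian_group.axioms(1)[OF g]]
    abelian_monoid.a_comm[OF abelian_group.axioms(1)[OF g]]
    abelian_monoid.a_lcomm[OF abelian_group.axioms(1)[OF g]]
    abelian_monoid.l_zero[OF abelian_group.axioms(1)[OF g]]
    abelian_monoid.r_zero[OF abelian_group.axioms(1)[OF g]]
  have ag: "abelian_group (pm_space (direct_sum I M) a)" for a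
  proof (rule abelian_groupI)
    fix x assume x: "x \<in> carrier (pm_space (direct_sum I M) a)"
    show "\<exists>y\<in>carrier (pm_space (direct_sum I M) a).
        y \<oplus>\<^bsub>pm_space (direct_sum I M) a\<^esub> x = \<zero>\<^bsub>pm_space (direct_sum I M) a\<^esub>"
      using x by (intro bexI[where x = "\<lambda>i\<in>I. \<ominus>\<^bsub>pm_space (M i) a\<^esub> x i"])
        (auto simp: direct_sum_def PiE_iff fun_eq_iff abelian_group.l_neg[OF g]
          abelian_group.a_inv_closed[OF g])
  qed (auto simp: direct_sum_def PiE_iff gs extensional_def fun_eq_iff)
  have mod: "Module.module R (pm_space (direct_sum I M) a)" for a
    by (rule Module.moduleI[OF _ ag])
      (auto simp: R.is_cring direct_sum_def PiE_iff extensional_def fun_eq_iff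
        Module.module.smult_closed[OF m] Module.module.smult_l_distr[OF m]
        Module.module.smult_r_distr[OF m] Module.module.smult_assoc1[OF m]
        Module.module.smult_one[OF m] gs)
  note l = linear_mapsD[OF persistence_module.linear[OF M]]
  show ?thesis
  proof (intro persistence_module.intro persistence_module_axioms.intro)
    show "pm_map (direct_sum I M) a b \<in>
        linear_maps R (pm_space (direct_sum I M) a) (pm_space (direct_sum I M) b)"
      if "a \<le> b" for a b
      using that by (auto simp: linear_maps_def direct_sum_def PiE_iff l)
  next
    fix a x assume "x \<in> carrier (pm_space (direct_sum I M) a)"
    then show "pm_map (direct_sum I M) a a x = x"
      by (auto simp: direct_sum_def PiE_iff extensional_def persistence_module.identity[OF M])
  next
    fix a b c x
    assume "a \<le> b" "b \<le> c" "x \<in> carrier (pm_space (direct_sum I M) a)"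
    then show "pm_map (direct_sum I M) b c (pm_map (direct_sum I M) a b x) =
        pm_map (direct_sum I M) a c x"
      by (auto simp: direct_sum_def PiE_iff persistence_module.composition[OF M])
  qed (fact R mod)+
qed

lemma pm_iso_refl: "pm_iso R M M"
  unfolding pm_iso_def
  by (intro exI[where x = "\<lambda>_ x. x"]) (auto simp: shift_morphism_def linear_maps_def)

lemma pm_iso_sym: "pm_iso R M N \<Longrightarrow> pm_iso R N M"
  unfolding pm_iso_def by blast

lemma shift_morphism_comp:
  assumes f: "shift_morphism R \<delta> L M f" and g: "shift_morphism R \<epsilon> M N g"
  shows "shift_morphism R (\<delta> + \<epsilon>) L N (\<lambda>a x. g (a + \<delta>) (f a x))"
  using assms unfolding shift_morphism_def linear_maps_def
  by (auto simp: Pi_iff add.assoc[symmetric])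

lemma pm_iso_trans:
  assumes "pm_iso R L M" "pm_iso R M N"
  shows "pm_iso R L N"
proof -
  obtain f g where fg: "shift_morphism R 0 L M f" "shift_morphism R 0 M L g"
    "\<And>a x. x \<in> carrier (pm_space L a) \<Longrightarrow> g a (f a x) = x"
    "\<And>a x. x \<in> carrier (pm_space M a) \<Longrightarrow> f a (g a x) = x"
    using assms(1) unfolding pm_iso_def by blast
  obtain h k where hk: "shift_morphism R 0 M N h" "shift_morphism R 0 N M k"
    "\<And>a x. x \<in> carrier (pm_space M a) \<Longrightarrow> k a (h a x) = x"
    "\<And>a x. x \<in> carrier (pm_space N a) \<Longrightarrow> h a (k a x) = x"
    using assms(2) unfolding pm_iso_def by blast
  have c: "f a x \<in> carrier (pm_space M a)" if "x \<in> carrier (pm_space L a)" for a x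
    using fg(1) that by (auto simp: shift_morphism_def linear_maps_def)
  have d: "k a x \<in> carrier (pm_space M a)" if "x \<in> carrier (pm_space N a)" for a x
    using hk(2) that by (auto simp: shift_morphism_def linear_maps_def)
  show ?thesis
    unfolding pm_iso_def
    using shift_morphism_comp[OF fg(1) hk(1)] shift_morphism_comp[OF hk(2) fg(2)]
    by (intro exI[where x = "\<lambda>a x. h a (f a x)"] exI[where x = "\<lambda>a x. g a (k a x)"])
      (auto simp: fg hk c d)
qed

lemma interleaved_iso:
  assumes "pm_iso R M M'" "pm_iso R N N'" "0 \<le> \<epsilon>" "interleaved R \<epsilon> M N"
  shows "interleaved R \<epsilon> M' N'"
proof -
  obtain f g where fg: "shift_morphism R 0 M M' f" "shift_morphism R 0 M' M g"
    "\<And>a x. x \<in> carrier (pm_space M a) \<Longrightarrow> g a (f a x) = x"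
    "\<And>a x. x \<in> carrier (pm_space M' a) \<Longrightarrow> f a (g a x) = x"
    using assms(1) unfolding pm_iso_def by blast
  obtain h k where hk: "shift_morphism R 0 N N' h" "shift_morphism R 0 N' N k"
    "\<And>a x. x \<in> carrier (pm_space N a) \<Longrightarrow> k a (h a x) = x"
    "\<And>a x. x \<in> carrier (pm_space N' a) \<Longrightarrow> h a (k a x) = x"
    using assms(2) unfolding pm_iso_def by blast
  obtain \<phi> \<psi> where pp: "shift_morphism R \<epsilon> M N \<phi>" "shift_morphism R \<epsilon> N M \<psi>"
    "\<And>a x. x \<in> carrier (pm_space M a) \<Longrightarrow> \<psi> (a + \<epsilon>) (\<phi> a x) = pm_map M a (a + 2 * \<epsilon>) x"
    "\<And>a x. x \<in> carrier (pm_space N a) \<Longrightarrow> \<phi> (a + \<epsilon>) (\<psi> a x) = pm_map N a (a + 2 * \<epsilon>) x"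
    using assms(4) unfolding interleaved_def by blast
  have c: "g a x \<in> carrier (pm_space M a)" if "x \<in> carrier (pm_space M' a)" for a x
    using fg(2) that by (auto simp: shift_morphism_def linear_maps_def)
  have d: "k a x \<in> carrier (pm_space N a)" if "x \<in> carrier (pm_space N' a)" for a x
    using hk(2) that by (auto simp: shift_morphism_def linear_maps_def)
  have e: "\<phi> a x \<in> carrier (pm_space N (a + \<epsilon>))" if "x \<in> carrier (pm_space M a)" for a x
    using pp(1) that by (auto simp: shift_morphism_def linear_maps_def)
  have e': "\<psi> a x \<in> carrier (pm_space M (a + \<epsilon>))" if "x \<in> carrier (pm_space N a)" for a x
    using pp(2) that by (auto simp: shift_morphism_def linear_maps_def)
  have n: "f b (pm_map M a b x) = pm_map M' a b (f a x)"
    if "a \<le> b" "x \<in> carrier (pm_space M a)" for a b x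
    using fg(1) that by (auto simp: shift_morphism_def)
  have n': "h b (pm_map N a b x) = pm_map N' a b (h a x)"
    if "a \<le> b" "x \<in> carrier (pm_space N a)" for a b x
    using hk(1) that by (auto simp: shift_morphism_def)
  have s: "shift_morphism R \<epsilon> M' N' (\<lambda>a x. h (a + \<epsilon>) (\<phi> a (g a x)))"
    using shift_morphism_comp[OF shift_morphism_comp[OF fg(2) pp(1)] hk(1)] by simp
  have s': "shift_morphism R \<epsilon> N' M' (\<lambda>a x. f (a + \<epsilon>) (\<psi> a (k a x)))"
    using shift_morphism_comp[OF shift_morphism_comp[OF hk(2) pp(2)] fg(1)] by simp
  have two: "a + \<epsilon> + \<epsilon> = a + 2 * \<epsilon>" for a :: real by simp
  show ?thesis
    unfolding interleaved_def
  proof (intro exI conjI allI ballI)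
    fix a x assume x: "x \<in> carrier (pm_space M' a)"
    show "f (a + \<epsilon> + \<epsilon>) (\<psi> (a + \<epsilon>) (k (a + \<epsilon>) (h (a + \<epsilon>) (\<phi> a (g a x))))) =
        pm_map M' a (a + 2 * \<epsilon>) x"
      using x assms(3) by (simp add: c e hk pp n fg two)
  next
    fix a x assume x: "x \<in> carrier (pm_space N' a)"
    show "h (a + \<epsilon> + \<epsilon>) (\<phi> (a + \<epsilon>) (g (a + \<epsilon>) (f (a + \<epsilon>) (\<psi> a (k a x))))) =
        pm_map N' a (a + 2 * \<epsilon>) x"
      using x assms(3) by (simp add: d e' hk pp n' fg two)
  qed (rule s s')+
qed

lemma interleaving_dist_iso:
  assumes "pm_iso R M M'" "pm_iso R N N'"
  shows "interleaving_dist R M' N' = interleaving_dist R M N"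
proof -
  have "{\<epsilon>. 0 \<le> \<epsilon> \<and> interleaved R \<epsilon> M' N'} = {\<epsilon>. 0 \<le> \<epsilon> \<and> interleaved R \<epsilon> M N}"
    using interleaved_iso[OF assms] interleaved_iso[OF pm_iso_sym pm_iso_sym, OF assms] by blast
  then show ?thesis by (simp add: interleaving_dist_def)
qed

lemma class_dist_iso_class:
  assumes "persistence_module R M" "persistence_module R N"
  shows "class_dist R (iso_class R M) (iso_class R N) = interleaving_dist R M N"
proof -
  have ne: "iso_class R M \<noteq> {}" "iso_class R N \<noteq> {}"
    using assms pm_iso_refl by (auto simp: iso_class_def)
  have "class_dist R (iso_class R M) (iso_class R N) =
      (INF M'\<in>iso_class R M. INF N'\<in>iso_class R N. interleaving_dist R M N)"
    unfolding class_dist_def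
    by (intro INF_cong refl) (auto simp: iso_class_def intro: interleaving_dist_iso)
  then show ?thesis using ne by simp
qed

lemma iso_class_eq_iff:
  assumes "persistence_module R M" "persistence_module R N"
  shows "iso_class R M = iso_class R N \<longleftrightarrow> pm_iso R M N"
  using assms by (auto simp: iso_class_def intro: pm_iso_refl pm_iso_sym pm_iso_trans)

end

theory Submission
  imports Defs
begin

text \<open>
  The key fact is that interval modules depend continuously on the interval: if every point of
  \<open>J\<close> lies within \<open>\<epsilon>\<close> of \<open>J'\<close> and conversely, then the interval modules of \<open>J\<close> and \<open>J'\<close> are
  \<open>\<epsilon>\<close>-interleaved (\<open>interleaved_interval_module\<close>), and interleavings can be assembled summand by
  summand (\<open>interleaved_direct_sum\<close>).

  To get countability, cut the line into the cells \<open>[m / k, (m + 1) / k)\<close> with \<open>m\<close> an integer. Two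
  intervals that meet the same cells are within \<open>1 / k\<close> of each other. The cells met by an interval
  are indexed by an order-convex set of integers, and there are only countably many of these
  (\<open>countable_convex_int_sets\<close>). So for each \<open>k\<close> the finite direct sums of interval modules fall
  into countably many groups, any two members of a group being \<open>1 / k\<close>-interleaved. Given any set
  \<open>\<S>\<close> of such sums, choosing one member of \<open>\<S>\<close> from every nonempty group, for all \<open>k\<close>, gives a
  countable dense subset of \<open>\<S>\<close> (\<open>separable_subset_fid\<close>). Choosing members of \<open>\<S>\<close>, rather than
  intervals with rational endpoints, makes a single argument serve for all three spaces, as the
  approximating intervals then inherit boundedness or containment in \<open>[c, d]\<close> from \<open>\<S>\<close>.

  Density concerns the topology generated by the balls, so it also has to be known that
  a ball contains a smaller ball around each of its points; this is the triangle inequality, that is,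
  the composition of interleavings (\<open>interleaved_trans\<close>).
\<close>


section \<open>Interleavings\<close>

lemma interleaved_refl:
  assumes "persistence_module R M"
  shows "interleaved R 0 M M"
  unfolding interleaved_def
  by (intro exI[where x = "\<lambda>_ x. x"])
    (auto simp: shift_morphism_def linear_maps_def persistence_module.identity[OF assms])

lemma shift_morphismD:
  assumes "shift_morphism R \<epsilon> M N \<phi>"
  shows "x \<in> carrier (pm_space M a) \<Longrightarrow> \<phi> a x \<in> carrier (pm_space N (a + \<epsilon>))"
    and "a \<le> b \<Longrightarrow> x \<in> carrier (pm_space M a) \<Longrightarrow>
      \<phi> b (pm_map M a b x) = pm_map N (a + \<epsilon>) (b + \<epsilon>) (\<phi> a x)"
  using assms by (auto simp: shift_morphism_def linear_maps_def)

text \<open>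
  The round trip \<open>L \<rightarrow> M \<rightarrow> N \<rightarrow> M \<rightarrow> L\<close> of a composite interleaving contains the round trip of the
  inner one, which is a structure map of \<open>M\<close>. By naturality that structure map can be moved past
  the outer morphism into \<open>L\<close>, where it composes with the outer round trip.
\<close>

lemma round_trip_comp:
  assumes L: "persistence_module R L" and nn: "0 \<le> \<delta>" "0 \<le> \<epsilon>"
    and f: "shift_morphism R \<delta> L M f" and g: "shift_morphism R \<delta> M L g"
    and gf: "\<And>a x. x \<in> carrier (pm_space L a) \<Longrightarrow> g (a + \<delta>) (f a x) = pm_map L a (a + 2 * \<delta>) x"
    and kh: "\<And>a x. x \<in> carrier (pm_space M a) \<Longrightarrow> k (a + \<epsilon>) (h a x) = pm_map M a (a + 2 * \<epsilon>) x"
    and x: "x \<in> carrier (pm_space L a)"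
  shows "g (a + (\<delta> + \<epsilon>) + \<epsilon>) (k (a + (\<delta> + \<epsilon>)) (h (a + \<delta>) (f a x))) =
    pm_map L a (a + 2 * (\<delta> + \<epsilon>)) x"
proof -
  have fx: "f a x \<in> carrier (pm_space M (a + \<delta>))"
    using shift_morphismD(1)[OF f x] .
  have e: "a + (\<delta> + \<epsilon>) = a + \<delta> + \<epsilon>" "a + \<delta> + \<epsilon> + \<epsilon> = a + \<delta> + 2 * \<epsilon>" "a + \<delta> + \<delta> = a + 2 * \<delta>"
    "a + \<delta> + 2 * \<epsilon> + \<delta> = a + 2 * (\<delta> + \<epsilon>)"
    by auto
  have "g (a + \<delta> + 2 * \<epsilon>) (pm_map M (a + \<delta>) (a + \<delta> + 2 * \<epsilon>) (f a x)) =
      pm_map L (a + \<delta> + \<delta>) (a + \<delta> + 2 * \<epsilon> + \<delta>) (g (a + \<delta>) (f a x))"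
    using nn fx by (intro shift_morphismD(2)[OF g]) auto
  also have "\<dots> = pm_map L a (a + 2 * (\<delta> + \<epsilon>)) x"
    unfolding e gf[OF x] using nn x by (intro persistence_module.composition[OF L]) auto
  finally show ?thesis
    unfolding e kh[OF fx] .
qed

lemma interleaved_trans:
  assumes L: "persistence_module R L" and N: "persistence_module R N"
    and nn: "0 \<le> \<delta>" "0 \<le> \<epsilon>"
    and LM: "interleaved R \<delta> L M" and MN: "interleaved R \<epsilon> M N"
  shows "interleaved R (\<delta> + \<epsilon>) L N"
proof -
  obtain f g where fg: "shift_morphism R \<delta> L M f" "shift_morphism R \<delta> M L g"
    "\<And>a x. x \<in> carrier (pm_space L a) \<Longrightarrow> g (a + \<delta>) (f a x) = pm_map L a (a + 2 * \<delta>) x"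
    "\<And>a x. x \<in> carrier (pm_space M a) \<Longrightarrow> f (a + \<delta>) (g a x) = pm_map M a (a + 2 * \<delta>) x"
    using LM unfolding interleaved_def by blast
  obtain h k where hk: "shift_morphism R \<epsilon> M N h" "shift_morphism R \<epsilon> N M k"
    "\<And>a x. x \<in> carrier (pm_space M a) \<Longrightarrow> k (a + \<epsilon>) (h a x) = pm_map M a (a + 2 * \<epsilon>) x"
    "\<And>a x. x \<in> carrier (pm_space N a) \<Longrightarrow> h (a + \<epsilon>) (k a x) = pm_map N a (a + 2 * \<epsilon>) x"
    using MN unfolding interleaved_def by blast
  show ?thesis
    unfolding interleaved_def
  proof (intro exI conjI allI ballI)
    show "shift_morphism R (\<delta> + \<epsilon>) L N (\<lambda>a x. h (a + \<delta>) (f a x))"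
      by (rule shift_morphism_comp[OF fg(1) hk(1)])
    show "shift_morphism R (\<delta> + \<epsilon>) N L (\<lambda>a x. g (a + \<epsilon>) (k a x))"
      using shift_morphism_comp[OF hk(2) fg(2)] by (simp add: add.commute)
  next
    fix a x assume "x \<in> carrier (pm_space L a)"
    then show "g (a + (\<delta> + \<epsilon>) + \<epsilon>) (k (a + (\<delta> + \<epsilon>)) (h (a + \<delta>) (f a x))) =
        pm_map L a (a + 2 * (\<delta> + \<epsilon>)) x"
      by (intro round_trip_comp[where k = k and h = h, OF L nn fg(1-3) hk(3)])
  next
    fix a x assume "x \<in> carrier (pm_space N a)"
    then show "h (a + (\<delta> + \<epsilon>) + \<delta>) (f (a + (\<delta> + \<epsilon>)) (g (a + \<epsilon>) (k a x))) =
        pm_map N a (a + 2 * (\<delta> + \<epsilon>)) x"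
      unfolding add.commute[of \<delta> \<epsilon>]
      by (intro round_trip_comp[where k = f and h = g, OF N nn(2,1) hk(2,1,4) fg(4)])
  qed
qed

lemma shift_morphism_direct_sum:
  assumes "\<And>i. i \<in> I \<Longrightarrow> shift_morphism R \<epsilon> (M i) (N i) (\<phi> i)"
  shows "shift_morphism R \<epsilon> (direct_sum I M) (direct_sum I N) (\<lambda>a x. \<lambda>i\<in>I. \<phi> i a (x i))"
  using assms unfolding shift_morphism_def linear_maps_def direct_sum_def
  by (auto simp: PiE_iff Pi_iff fun_eq_iff)

lemma interleaved_direct_sum:
  assumes "\<And>i. i \<in> I \<Longrightarrow> interleaved R \<epsilon> (M i) (N i)"
  shows "interleaved R \<epsilon> (direct_sum I M) (direct_sum I N)"
proof -
  obtain \<phi> \<psi> where *: "\<And>i. i \<in> I \<Longrightarrow> shift_morphism R \<epsilon> (M i) (N i) (\<phi> i)"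
    "\<And>i. i \<in> I \<Longrightarrow> shift_morphism R \<epsilon> (N i) (M i) (\<psi> i)"
    "\<And>i a x. i \<in> I \<Longrightarrow> x \<in> carrier (pm_space (M i) a) \<Longrightarrow>
      \<psi> i (a + \<epsilon>) (\<phi> i a x) = pm_map (M i) a (a + 2 * \<epsilon>) x"
    "\<And>i a x. i \<in> I \<Longrightarrow> x \<in> carrier (pm_space (N i) a) \<Longrightarrow>
      \<phi> i (a + \<epsilon>) (\<psi> i a x) = pm_map (N i) a (a + 2 * \<epsilon>) x"
    using assms unfolding interleaved_def by metis
  show ?thesis
    unfolding interleaved_def
  proof (intro exI conjI allI ballI)
    show "shift_morphism R \<epsilon> (direct_sum I M) (direct_sum I N) (\<lambda>a x. \<lambda>i\<in>I. \<phi> i a (x i))"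
      by (rule shift_morphism_direct_sum[OF *(1)])
    show "shift_morphism R \<epsilon> (direct_sum I N) (direct_sum I M) (\<lambda>a x. \<lambda>i\<in>I. \<psi> i a (x i))"
      by (rule shift_morphism_direct_sum[OF *(2)])
  qed (auto simp: direct_sum_def PiE_iff fun_eq_iff *)
qed


section \<open>Interval modules of nearby intervals\<close>

text \<open>
  The candidate morphism is the identity wherever both source and target are the ground field.
  Naturality can only fail when \<open>a \<in> J\<close> and \<open>b + \<epsilon> \<in> J'\<close>, where \<open>a \<le> b\<close>. In that case both routes
  are the identity: a point of \<open>J\<close> near \<open>b + \<epsilon>\<close> lies to the right of \<open>b\<close>, whence \<open>b \<in> J\<close>, and a point
  of \<open>J'\<close> near \<open>a\<close> lies to the left of \<open>a + \<epsilon>\<close>, whence \<open>a + \<epsilon> \<in> J'\<close>.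
\<close>

lemma shift_morphism_interval_module:
  assumes R: "Ring.field R" and J: "is_interval J" "is_interval J'"
    and JJ': "\<And>x. x \<in> J \<Longrightarrow> \<exists>y\<in>J'. \<bar>x - y\<bar> \<le> \<epsilon>" and J'J: "\<And>y. y \<in> J' \<Longrightarrow> \<exists>x\<in>J. \<bar>x - y\<bar> \<le> \<epsilon>"
  shows "shift_morphism R \<epsilon> (interval_module R J) (interval_module R J')
    (\<lambda>a x. if a \<in> J \<and> a + \<epsilon> \<in> J' then x else \<zero>\<^bsub>R\<^esub>)"
proof -
  interpret Ring.field R by fact
  have 1: "b \<in> J" if "a \<in> J" "b + \<epsilon> \<in> J'" "a \<le> b" for a b
  proof -
    obtain z where "z \<in> J" "\<bar>z - (b + \<epsilon>)\<bar> \<le> \<epsilon>" using J'J \<open>b + \<epsilon> \<in> J'\<close> by blast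
    then show ?thesis
      using that J(1) unfolding is_interval_1 by (smt (verit))
  qed
  have 2: "a + \<epsilon> \<in> J'" if "a \<in> J" "b + \<epsilon> \<in> J'" "a \<le> b" for a b
  proof -
    obtain z where "z \<in> J'" "\<bar>a - z\<bar> \<le> \<epsilon>" using JJ' \<open>a \<in> J\<close> by blast
    then show ?thesis
      using that J(2) unfolding is_interval_1 by (smt (verit))
  qed
  show ?thesis
    unfolding shift_morphism_def
  proof (intro conjI allI impI ballI)
    fix a b :: real and x assume "a \<le> b"
    then show "(if b \<in> J \<and> b + \<epsilon> \<in> J' then pm_map (interval_module R J) a b x else \<zero>\<^bsub>R\<^esub>) =
      pm_map (interval_module R J') (a + \<epsilon>) (b + \<epsilon>) (if a \<in> J \<and> a + \<epsilon> \<in> J' then x else \<zero>\<^bsub>R\<^esub>)"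
      using 1[of a b] 2[of a b] by (auto simp: interval_module_def)
  qed (auto simp: linear_maps_def interval_module_def split: if_splits)
qed

text \<open>
  This makes the round trip \<open>J \<rightarrow> J' \<rightarrow> J\<close> from \<open>a\<close> to \<open>a + 2 * \<epsilon>\<close> the identity whenever the structure
  map is: the intermediate space, at \<open>a + \<epsilon>\<close>, is then the ground field.
\<close>

lemma between_points_of_nearby_interval:
  fixes J' :: "real set"
  assumes "is_interval J'" and "\<And>x. x \<in> J \<Longrightarrow> \<exists>y\<in>J'. \<bar>x - y\<bar> \<le> \<epsilon>"
    and "a \<in> J" "a + 2 * \<epsilon> \<in> J"
  shows "a + \<epsilon> \<in> J'"
proof -
  obtain y z where "y \<in> J'" "\<bar>a - y\<bar> \<le> \<epsilon>" "z \<in> J'" "\<bar>a + 2 * \<epsilon> - z\<bar> \<le> \<epsilon>"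
    using assms by meson
  then show ?thesis
    using assms(1) unfolding is_interval_1 by (smt (verit))
qed

lemma interleaved_interval_module:
  assumes R: "Ring.field R" and J: "is_interval J" "is_interval J'"
    and JJ': "\<And>x. x \<in> J \<Longrightarrow> \<exists>y\<in>J'. \<bar>x - y\<bar> \<le> \<epsilon>" and J'J: "\<And>y. y \<in> J' \<Longrightarrow> \<exists>x\<in>J. \<bar>x - y\<bar> \<le> \<epsilon>"
  shows "interleaved R \<epsilon> (interval_module R J) (interval_module R J')"
proof -
  have J'J': "\<exists>x\<in>J. \<bar>y - x\<bar> \<le> \<epsilon>" if "y \<in> J'" for y
    using J'J[OF that] by (simp add: abs_minus_commute)
  have JJ: "\<exists>y\<in>J'. \<bar>y - x\<bar> \<le> \<epsilon>" if "x \<in> J" for x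
    using JJ'[OF that] by (simp add: abs_minus_commute)
  note mid = between_points_of_nearby_interval[OF J(2) JJ']
    between_points_of_nearby_interval[OF J(1) J'J']
  have two: "a + \<epsilon> + \<epsilon> = a + 2 * \<epsilon>" for a :: real by simp
  show ?thesis
    unfolding interleaved_def
    by (intro exI conjI allI ballI,
        rule shift_morphism_interval_module[OF R J JJ' J'J],
        assumption, assumption,
        rule shift_morphism_interval_module[OF R J(2,1) J'J' JJ])
      (auto simp: interval_module_def two mid split: if_splits)
qed


section \<open>Grid cells met by an interval\<close>

definition cells :: "nat \<Rightarrow> real set \<Rightarrow> int set" where
  "cells k J = (\<lambda>x. \<lfloor>real k * x\<rfloor>) ` J"

lemma cells_eq_imp_near:
  assumes "0 < k" "cells k J = cells k J'" "x \<in> J"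
  shows "\<exists>y\<in>J'. \<bar>x - y\<bar> \<le> 1 / real k"
proof -
  have "\<lfloor>real k * x\<rfloor> \<in> cells k J'"
    using assms by (auto simp: cells_def)
  then obtain y where y: "y \<in> J'" "\<lfloor>real k * x\<rfloor> = \<lfloor>real k * y\<rfloor>"
    by (auto simp: cells_def)
  have "\<bar>real k * x - real k * y\<bar> \<le> 1"
    using y(2) by linarith
  then have "real k * \<bar>x - y\<bar> \<le> 1"
    by (metis abs_mult abs_of_nat right_diff_distrib)
  then have "\<bar>x - y\<bar> \<le> 1 / real k"
    using \<open>0 < k\<close> by (simp add: field_simps)
  with y(1) show ?thesis by blast
qed

text \<open>
  An integer strictly above one cell met by \<open>J\<close> and at most another is the left end, scaled by
  \<open>k\<close>, of its own cell, and this left end lies between two points of \<open>J\<close>.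
\<close>

lemma cells_convex:
  assumes J: "is_interval J" and k: "0 < k" and m: "m \<in> cells k J" "n \<in> cells k J"
  shows "{m..n} \<subseteq> cells k J"
proof
  fix p assume p: "p \<in> {m..n}"
  obtain x y where xy: "x \<in> J" "m = \<lfloor>real k * x\<rfloor>" "y \<in> J" "n = \<lfloor>real k * y\<rfloor>"
    using m by (auto simp: cells_def)
  show "p \<in> cells k J"
  proof (cases "p = m")
    case False
    define z where "z = of_int p / real k"
    have kz: "real k * z = of_int p"
      using k by (simp add: z_def)
    have "real k * x \<le> real k * z" "real k * z \<le> real k * y"
      using p False xy by (auto simp: kz le_floor_iff; linarith)+
    then have "x \<le> z" "z \<le> y"
      using k by auto
    then have "z \<in> J"
      using J xy unfolding is_interval_1 by blast
    then show ?thesis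
      by (auto simp: cells_def image_iff kz intro!: bexI[of _ z])
  qed (use m in simp)
qed

text \<open>
  Such a set is an intersection of an up-set and a down-set, and an up-set of integers is empty,
  everything, or has a least element.
\<close>

lemma countable_convex_int_sets:
  "countable {T :: int set. \<forall>m\<in>T. \<forall>n\<in>T. {m..n} \<subseteq> T}"
proof -
  let ?U = "insert {} (insert UNIV (range atLeast)) :: int set set"
  let ?D = "insert {} (insert UNIV (range atMost)) :: int set set"
  have up: "A \<in> ?U" if A: "\<And>m n. m \<in> A \<Longrightarrow> m \<le> n \<Longrightarrow> n \<in> A" for A :: "int set"
  proof (cases "A = {} \<or> \<not> bdd_below A")
    case True
    have "n \<in> A" if "\<not> bdd_below A" for n
      using that A by (metis bdd_below_def linear)
    with True have "A = {} \<or> A = UNIV" by auto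
    then show ?thesis by (elim disjE) simp_all
  next
    case False
    then obtain l m where l: "\<And>n. n \<in> A \<Longrightarrow> l \<le> n" and "m \<in> A"
      unfolding bdd_below_def by blast
    then obtain p where p: "p \<in> A" "\<And>n. n \<in> A \<Longrightarrow> nat (p - l) \<le> nat (n - l)"
      using ex_has_least_nat[of "\<lambda>n. n \<in> A" m "\<lambda>n. nat (n - l)"] by blast
    have "A = {p..}"
    proof (intro equalityI subsetI)
      fix n assume "n \<in> A"
      with p(2)[OF this] l[OF p(1)] l[OF this] show "n \<in> {p..}" by simp
    next
      fix n assume "n \<in> {p..}"
      with A[OF p(1)] show "n \<in> A" by simp
    qed
    then show ?thesis by blast
  qed
  have down: "B \<in> ?D" if B: "\<And>m n. n \<in> B \<Longrightarrow> m \<le> n \<Longrightarrow> m \<in> B" for B :: "int set"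
  proof -
    have "uminus ` B \<in> ?U"
    proof (rule up)
      fix m n assume "m \<in> uminus ` B" "m \<le> n"
      then have "- n \<in> B" by (auto intro: B)
      then show "n \<in> uminus ` B" by force
    qed
    then have "uminus ` uminus ` B \<in> (`) uminus ` ?U"
      by (rule imageI)
    then show ?thesis
      by (auto simp: image_image)
  qed
  have "{T :: int set. \<forall>m\<in>T. \<forall>n\<in>T. {m..n} \<subseteq> T} \<subseteq> (\<lambda>(A, B). A \<inter> B) ` (?U \<times> ?D)"
  proof clarify
    fix T :: "int set" assume T: "\<forall>m\<in>T. \<forall>n\<in>T. {m..n} \<subseteq> T"
    have "T = {n. \<exists>m\<in>T. m \<le> n} \<inter> {m. \<exists>n\<in>T. m \<le> n}"
      using T by (auto simp: subset_iff)
    moreover have "{n. \<exists>m\<in>T. m \<le> n} \<in> ?U"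
      by (rule up) (auto intro: order_trans)
    moreover have "{m. \<exists>n\<in>T. m \<le> n} \<in> ?D"
      by (rule down) (auto intro: order_trans)
    ultimately show "T \<in> (\<lambda>(A, B). A \<inter> B) ` (?U \<times> ?D)"
      by (intro image_eqI[where x = "({n. \<exists>m\<in>T. m \<le> n}, {m. \<exists>n\<in>T. m \<le> n})"])
        (simp_all only: case_prod_conv mem_Sigma_iff simp_thms)
  qed
  then show ?thesis
    by (rule countable_subset) auto
qed


section \<open>Separability\<close>

abbreviation interval_sum ::
  "('k, 'r) ring_scheme \<Rightarrow> nat \<Rightarrow> (nat \<Rightarrow> real set) \<Rightarrow> ('k, nat \<Rightarrow> 'k) pers" where
  "interval_sum R n J \<equiv> direct_sum {..<n} (\<lambda>i. interval_module R (J i))"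

lemma class_dist_less_iff:
  assumes "persistence_module R M" "persistence_module R N"
  shows "class_dist R (iso_class R M) (iso_class R N) < ereal r \<longleftrightarrow>
    (\<exists>\<epsilon>. 0 \<le> \<epsilon> \<and> \<epsilon> < r \<and> interleaved R \<epsilon> M N)"
  by (auto simp: class_dist_iso_class[OF assms] interleaving_dist_def INF_less_iff)

lemma topspace_interleaving_topology:
  assumes S: "\<And>X. X \<in> \<S> \<Longrightarrow> \<exists>M. persistence_module R M \<and> X = iso_class R M"
  shows "topspace (interleaving_topology R \<S>) = \<S>"
proof -
  have "class_dist R X X < ereal 1" if X: "X \<in> \<S>" for X
  proof -
    obtain M where M: "persistence_module R M" "X = iso_class R M"
      using S[OF X] by blast
    then show ?thesis
      using interleaved_refl[OF M(1)] by (auto simp: class_dist_less_iff intro!: exI[of _ 0])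
  qed
  then show ?thesis
    unfolding interleaving_topology_def topology_generated_by_topspace
    by (auto intro: zero_less_one)
qed

text \<open>
  Finite intersections and unions preserve the property of containing a ball around each point; that
  the generating balls themselves have it is the triangle inequality.
\<close>

lemma openin_interleaving_topology_ball:
  assumes S: "\<And>X. X \<in> \<S> \<Longrightarrow> \<exists>M. persistence_module R M \<and> X = iso_class R M"
    and U: "openin (interleaving_topology R \<S>) U" and "Y \<in> U"
  shows "\<exists>r>0. \<forall>Z\<in>\<S>. class_dist R Y Z < ereal r \<longrightarrow> Z \<in> U"
proof -
  have "generate_topology_on {{Y \<in> \<S>. class_dist R X Y < ereal r} | X r. X \<in> \<S> \<and> 0 < r} U"
    using U by (simp add: interleaving_topology_def openin_topology_generated_by_iff)
  then show ?thesis
    using \<open>Y \<in> U\<close>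
  proof (induction arbitrary: Y rule: generate_topology_on.induct)
    case (Int A B)
    then have "Y \<in> A" "Y \<in> B" by auto
    obtain r where r: "0 < r" "\<forall>Z\<in>\<S>. class_dist R Y Z < ereal r \<longrightarrow> Z \<in> A"
      using Int.IH(1)[OF \<open>Y \<in> A\<close>] by blast
    obtain s where s: "0 < s" "\<forall>Z\<in>\<S>. class_dist R Y Z < ereal s \<longrightarrow> Z \<in> B"
      using Int.IH(2)[OF \<open>Y \<in> B\<close>] by blast
    show ?case
    proof (intro exI conjI ballI impI)
      show "0 < min r s" using r(1) s(1) by simp
      fix Z assume "Z \<in> \<S>" "class_dist R Y Z < ereal (min r s)"
      then show "Z \<in> A \<inter> B" using r(2) s(2) by (simp add: ereal_min)
    qed
  next
    case (UN K)
    then show ?case by (meson UnionE UnionI)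
  next
    case (Basis B)
    then obtain X r where X: "X \<in> \<S>" "B = {Y \<in> \<S>. class_dist R X Y < ereal r}" by blast
    then obtain L M where LM: "persistence_module R L" "X = iso_class R L"
      "persistence_module R M" "Y = iso_class R M"
      using S Basis.prems by blast
    then obtain \<delta> where \<delta>: "0 \<le> \<delta>" "\<delta> < r" "interleaved R \<delta> L M"
      using X Basis.prems by (auto simp: class_dist_less_iff)
    show ?case
    proof (intro exI conjI ballI impI)
      show "0 < r - \<delta>" using \<delta> by simp
      fix Z assume Z: "Z \<in> \<S>" "class_dist R Y Z < ereal (r - \<delta>)"
      then obtain N where N: "persistence_module R N" "Z = iso_class R N"
        using S by blast
      then obtain \<epsilon> where \<epsilon>: "0 \<le> \<epsilon>" "\<epsilon> < r - \<delta>" "interleaved R \<epsilon> M N"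
        using Z LM by (auto simp: class_dist_less_iff)
      have "interleaved R (\<delta> + \<epsilon>) L N"
        using interleaved_trans[OF LM(1) N(1) \<delta>(1) \<epsilon>(1) \<delta>(3) \<epsilon>(3)] .
      then have "class_dist R X Z < ereal r"
        unfolding LM N class_dist_less_iff[OF LM(1) N(1)]
        using \<delta> \<epsilon> by (intro exI[of _ "\<delta> + \<epsilon>"]) auto
      with Z X show "Z \<in> B" by simp
    qed
  qed simp
qed

lemma interleaved_if_same_cells:
  assumes R: "Ring.field R" and k: "0 < k"
    and J: "\<And>i. i < n \<Longrightarrow> is_interval (J i)" "\<And>i. i < n \<Longrightarrow> is_interval (J' i)"
    and eq: "\<And>i. i < n \<Longrightarrow> cells k (J i) = cells k (J' i)"
  shows "interleaved R (1 / real k) (interval_sum R n J) (interval_sum R n J')"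
proof (rule interleaved_direct_sum)
  fix i assume "i \<in> {..<n}"
  then have i: "i < n" by simp
  show "interleaved R (1 / real k) (interval_module R (J i)) (interval_module R (J' i))"
  proof (rule interleaved_interval_module[OF R J(1)[OF i] J(2)[OF i]])
    show "\<exists>y\<in>J' i. \<bar>x - y\<bar> \<le> 1 / real k" if "x \<in> J i" for x
      using cells_eq_imp_near[OF k eq[OF i] that] .
    show "\<exists>x\<in>J i. \<bar>x - y\<bar> \<le> 1 / real k" if "y \<in> J' i" for y
      using cells_eq_imp_near[OF k eq[OF i, symmetric] that] by (simp add: abs_minus_commute)
  qed
qed

text \<open>
  Group the members of \<open>\<S>\<close> by the list of cell sets of their intervals; the length of the list
  records the number of summands. The same class may be presented by several families of intervals,
  so one presentation per class is fixed before its list is read off.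
\<close>

theorem separable_subset_fid:
  assumes R: "Ring.field R" and sub: "\<S> \<subseteq> fid R"
  shows "separable_space (interleaving_topology R \<S>)"
proof -
  have "\<forall>X\<in>\<S>. \<exists>n J. X = iso_class R (interval_sum R n J) \<and> (\<forall>i<n. is_interval (J i))"
    using sub unfolding fid_def by blast
  then obtain n J where XnJ: "\<And>X. X \<in> \<S> \<Longrightarrow> X = iso_class R (interval_sum R (n X) (J X))"
    and int: "\<And>X i. X \<in> \<S> \<Longrightarrow> i < n X \<Longrightarrow> is_interval (J X i)"
    by metis
  have pm: "persistence_module R (interval_sum R (n X) (J X))" if "X \<in> \<S>" for X
    using int[OF that] by (intro direct_sum_persistence R interval_module_persistence) auto
  have S: "\<exists>M. persistence_module R M \<and> X = iso_class R M" if "X \<in> \<S>" for X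
    using XnJ[OF that] pm[OF that] by blast
  have top: "topspace (interleaving_topology R \<S>) = \<S>"
    using topspace_interleaving_topology S by blast
  define code where "code k X = map (\<lambda>i. cells k (J X i)) [0..<n X]" for k X
  have cnt: "countable (code k ` \<S>)" if k: "0 < k" for k
  proof (rule countable_subset)
    show "code k ` \<S> \<subseteq> lists {T. \<forall>m\<in>T. \<forall>n\<in>T. {m..n} \<subseteq> T}"
      using cells_convex[OF int k] by (fastforce simp: code_def)
    show "countable (lists {T :: int set. \<forall>m\<in>T. \<forall>n\<in>T. {m..n} \<subseteq> T})"
      by (rule countable_lists[OF countable_convex_int_sets])
  qed
  have near: "interleaved R (1 / real k) (interval_sum R (n X) (J X)) (interval_sum R (n Y) (J Y))"
    if XY: "X \<in> \<S>" "Y \<in> \<S>" and k: "0 < k" and eq: "code k X = code k Y" for k X Y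
  proof -
    have n: "n X = n Y"
      using arg_cong[OF eq, of length] by (simp add: code_def)
    have "cells k (J X i) = cells k (J Y i)" if "i < n Y" for i
      using arg_cong[OF eq, of "\<lambda>xs. xs ! i"] that n by (simp add: code_def)
    then show ?thesis
      unfolding n using int XY n by (intro interleaved_if_same_cells R k) auto
  qed
  define D where "D = (\<Union>k\<in>{0<..}. inv_into \<S> (code k) ` code k ` \<S>)"
  have D: "countable D" "D \<subseteq> \<S>"
    using cnt by (auto simp: D_def inv_into_into)
  have "\<exists>Y\<in>D. Y \<in> U" if X: "X \<in> \<S>" "X \<in> U" and U: "openin (interleaving_topology R \<S>) U" for X U
  proof -
    obtain r where r: "0 < r" "\<And>Z. Z \<in> \<S> \<Longrightarrow> class_dist R X Z < ereal r \<Longrightarrow> Z \<in> U"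
      using openin_interleaving_topology_ball[OF S U X(2)] by blast
    obtain k where k: "0 < k" "1 / real k < r"
      using reals_Archimedean2[of "1 / r"] r(1)
      by (metis divide_less_eq mult.commute of_nat_0_less_iff order_less_trans zero_less_divide_1_iff)
    define Y where "Y = inv_into \<S> (code k) (code k X)"
    have Y: "Y \<in> \<S>" "code k X = code k Y" "Y \<in> D"
      using X(1) k(1) by (auto simp: Y_def D_def inv_into_into f_inv_into_f)
    have "class_dist R (iso_class R (interval_sum R (n X) (J X)))
        (iso_class R (interval_sum R (n Y) (J Y))) < ereal r"
      unfolding class_dist_less_iff[OF pm[OF X(1)] pm[OF Y(1)]]
      using near[OF X(1) Y(1) k(1) Y(2)] k(2) by (intro exI[of _ "1 / real k"]) simp
    then have "class_dist R X Y < ereal r"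
      using XnJ[OF X(1)] XnJ[OF Y(1)] by argo
    then show ?thesis
      using r(2) Y by blast
  qed
  then have "(interleaving_topology R \<S>) closure_of D = \<S>"
    by (auto simp: closure_of_def top)
  then show ?thesis
    unfolding separable_space_def top using D by (intro exI[of _ D] conjI)
qed

theorem theorem4p18:
  fixes R :: "('k, 'r) ring_scheme" and c d :: real
  assumes "Ring.field R" and "c < d"
  shows "separable_space (interleaving_topology R (fid R)) \<and>
         separable_space (interleaving_topology R (ffid R)) \<and>
         separable_space (interleaving_topology R (ffid_within R c d))"
proof -
  have "ffid R \<subseteq> fid R" "ffid_within R c d \<subseteq> fid R"
    unfolding fid_def ffid_def ffid_within_def by blast+
  then show ?thesis
    using separable_subset_fid[OF assms(1)] by blast
qed

end
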